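(* Let $k\geq 1$, let $(p_n)_{n\ge 0}$ be a sequence of positive real numbers with $P_n=\sum_{v=0}^{n}p_v\to\infty$, let $(X_n)_{n\ge 1}$ be a quasi-$f$-power increasing sequence, where $f=(f_n(\sigma,\beta))=(n^{\sigma}(\log n)^{\beta})$ for some $\beta\ge 0$ and $0<\sigma<1$, and let $(\lambda_n)$ be a sequence. Let $\sum a_n$ be an infinite series and let $t_n=\frac{1}{n+1}\sum_{v=1}^{n}v a_v$. Let $A=(a_{nv})$ be a positive normal matrix such that $$\bar{a}_{n0}=1,\quad n=0,1,\dots,$$ $$a_{n-1,v}\geq a_{nv}\quad\text{for } n\geq v+1,$$ $$a_{nn}=O\left(\frac{p_n}{P_n}\right),$$ $$\sum_{v=1}^{n-1}\frac{1}{v}\hat{a}_{n,v+1}=O(a_{nn}).$$ Suppose that, as $m\to\infty$, $$\lambda_m X_m=O(1),$$ $$\sum_{n=1}^{m}nX_n|\Delta^{2}\lambda_n|=O(1),$$ $$\sum_{n=1}^{m}\frac{P_n}{n}=O(P_m),$$ $$\sum_{n=1}^{m}\frac{p_n}{P_n}\frac{|t_n|^{k}}{X_n^{k-1}}=O(X_m),$$ $$\sum_{n=1}^{m}\frac{|t_n|^{k}}{nX_n^{k-1}}=O(X_m).$$ Then the series $\sum a_n\lambda_n$ is summable $|A,p_n|_k$.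
   Context: A positive sequence $X=(X_n)_{n\ge1}$ is quasi-$f$-power increasing, where $f_n=n^{\sigma}(\log n)^{\beta}$ with $\beta\geq 0$, $0<\sigma<1$, if there is a constant $K=K(X,f)\geq 1$ such that $Kf_nX_n\geq f_mX_m$ for all $n\geq m\geq 1$ (when $\beta=0$, $f_n=n^\sigma$ for all $n\ge 1$). For a sequence $(\lambda_n)$: $\Delta\lambda_n=\lambda_n-\lambda_{n+1}$ and $\Delta^2\lambda_n=\Delta\lambda_n-\Delta\lambda_{n+1}$. A normal matrix $A=(a_{nv})_{n,v\ge 0}$ is a lower triangular matrix ($a_{nv}=0$ for $v>n$) with nonzero diagonal entries; it is positive if $a_{nv}>0$ for $0\le v\le n$. (The matrix entries $a_{nv}$ are unrelated to the series terms $a_n$.) Associated with $A$ are the lower semimatrices $\bar A=(\bar a_{nv})$ and $\hat A=(\hat a_{nv})$ given by $$\bar a_{nv}=\sum_{i=v}^{n}a_{ni},\quad n,v=0,1,\dots,\qquad \hat a_{00}=\bar a_{00}=a_{00},\quad \hat a_{nv}=\bar a_{nv}-\bar a_{n-1,v},\quad n=1,2,\dots$$ For a series $\sum c_n$ with partial sums $s_n=\sum_{v=0}^n c_v$, put $A_n(s)=\sum_{v=0}^{n}a_{nv}s_v$ and $\bar\Delta A_n(s)=A_n(s)-A_{n-1}(s)$. The series $\sum c_n$ is summable $|A,p_n|_k$, $k\ge 1$, if $$\sum_{n=1}^{\infty}\left(\frac{P_n}{p_n}\right)^{k-1}\left|\bar\Delta A_n(s)\right|^{k}<\infty.$$ The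 series $\sum a_n\lambda_n$ is taken over $n\ge 1$ (its term of index $0$ is $0$). *)

theory Defs
  imports Complex_Main "HOL-Library.Landau_Symbols"
begin

text \<open>
  All sequences are functions on \<^typ>\<open>nat\<close>. For sequences that the theory indexes from 1
  the value at 0 is never used. The series terms and the factor sequence take values in a
  type of class \<^class>\<open>real_normed_field\<close> and \<^class>\<open>banach\<close>, which covers exactly
  real and complex scalars.
\<close>

text \<open>
  The factor \<open>(log n)\<^sup>\<beta>\<close> is 1 for \<open>\<beta> = 0\<close>, also at \<open>n = 1\<close>; this needs a case
  distinction because \<open>0 powr 0 = 0\<close>.
\<close>
definition pow_log :: "real \<Rightarrow> real \<Rightarrow> nat \<Rightarrow> real" where
  "pow_log \<sigma> \<beta> n = real n powr \<sigma> * (if \<beta> = 0 then 1 else ln (real n) powr \<beta>)"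

definition quasi_power_increasing :: "(nat \<Rightarrow> real) \<Rightarrow> (nat \<Rightarrow> real) \<Rightarrow> bool" where
  "quasi_power_increasing f X \<longleftrightarrow>
     (\<forall>n\<ge>1. X n > 0) \<and>
     (\<exists>K\<ge>1. \<forall>m n. 1 \<le> m \<and> m \<le> n \<longrightarrow> K * f n * X n \<ge> f m * X m)"

definition fwd_diff :: "(nat \<Rightarrow> 'a::ab_group_add) \<Rightarrow> nat \<Rightarrow> 'a" where
  "fwd_diff u n = u n - u (Suc n)"

definition normal_matrix :: "(nat \<Rightarrow> nat \<Rightarrow> real) \<Rightarrow> bool" where
  "normal_matrix A \<longleftrightarrow> (\<forall>n v. n < v \<longrightarrow> A n v = 0) \<and> (\<forall>n. A n n \<noteq> 0)"

definition positive_normal_matrix :: "(nat \<Rightarrow> nat \<Rightarrow> real) \<Rightarrow> bool" where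
  "positive_normal_matrix A \<longleftrightarrow> normal_matrix A \<and> (\<forall>n v. v \<le> n \<longrightarrow> A n v > 0)"

definition bar_matrix :: "(nat \<Rightarrow> nat \<Rightarrow> real) \<Rightarrow> nat \<Rightarrow> nat \<Rightarrow> real" where
  "bar_matrix A n v = (\<Sum>i=v..n. A n i)"

definition hat_matrix :: "(nat \<Rightarrow> nat \<Rightarrow> real) \<Rightarrow> nat \<Rightarrow> nat \<Rightarrow> real" where
  "hat_matrix A n v =
     (if n = 0 then bar_matrix A 0 v else bar_matrix A n v - bar_matrix A (n - 1) v)"

definition psum :: "(nat \<Rightarrow> 'a::comm_monoid_add) \<Rightarrow> nat \<Rightarrow> 'a" where
  "psum c n = (\<Sum>v=0..n. c v)"

definition matrix_transform ::
  "(nat \<Rightarrow> nat \<Rightarrow> real) \<Rightarrow> (nat \<Rightarrow> 'a::real_normed_vector) \<Rightarrow> nat \<Rightarrow> 'a" where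
  "matrix_transform A s n = (\<Sum>v=0..n. A n v *\<^sub>R s v)"

text \<open>
  Summability \<open>|A, p\<^sub>n|\<^sub>k\<close> of the series with terms \<open>c\<close>. The sum starts at index 1,
  whence the shift by \<^term>\<open>Suc\<close>.
\<close>
definition abs_summable ::
  "(nat \<Rightarrow> nat \<Rightarrow> real) \<Rightarrow> (nat \<Rightarrow> real) \<Rightarrow> real \<Rightarrow> (nat \<Rightarrow> 'a::real_normed_vector) \<Rightarrow> bool" where
  "abs_summable A p k c \<longleftrightarrow>
     summable (\<lambda>n. (psum p (Suc n) / p (Suc n)) powr (k - 1) *
       norm (matrix_transform A (psum c) (Suc n) - matrix_transform A (psum c) n) powr k)"

definition t_mean :: "(nat \<Rightarrow> 'a::real_normed_field) \<Rightarrow> nat \<Rightarrow> 'a" where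
  "t_mean a n = (\<Sum>v=1..n. of_nat v * a v) / of_nat (n + 1)"

end

theory Submission
  imports Defs "HOL-Analysis.Convex"
begin

text \<open>
  Two Abel summations and one weighted Hoelder inequality carry the proof. The first
  summation (\<open>sum_hat_matrix_by_parts\<close>) writes the \<open>n\<close>-th difference of the matrix means in
  terms of the means \<open>t\<^sub>v\<close>. Up to signs and factors at most 2, it leaves a diagonal term
  \<open>a\<^sub>n\<^sub>n \<lambda>\<^sub>n t\<^sub>n\<close> and three sums over \<open>v < n\<close>, in which \<open>t\<^sub>v\<close> is
  multiplied by \<open>\<lambda>\<^sub>v\<close>, by \<open>v \<Delta>\<lambda>\<^sub>v\<close> and by \<open>\<lambda>\<^bsub>v+1\<^esub>\<close>, and
  weighted by the nonnegative kernels \<open>a\<^bsub>n-1,v\<^esub> - a\<^bsub>nv\<^esub>\<close> (first sum) and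
  \<open>\<hat>a\<^bsub>n,v+1\<^esub> / v\<close> (the other two). Both kernels have row sums
  \<open>O(a\<^sub>n\<^sub>n) = O(p\<^sub>n/P\<^sub>n)\<close>, which is exactly what the factor
  \<open>(P\<^sub>n/p\<^sub>n)\<^bsup>k-1\<^esup>\<close> can absorb after Hoelder's inequality; their column sums
  telescope to at most \<open>a\<^sub>v\<^sub>v\<close> and \<open>1/v\<close> (\<open>sum_triangle_kernel_powr_bound\<close>).

  What remains is to bound sums of the form
  \<open>\<Sum> g\<^sub>v (c\<^sub>v |t\<^sub>v|)\<^sup>k\<close> with \<open>g\<^sub>v\<close> equal to \<open>p\<^sub>v/P\<^sub>v\<close> or
  \<open>1/v\<close> and \<open>c\<^sub>v\<close> one of \<open>|\<lambda>\<^sub>v|\<close>, \<open>v |\<Delta>\<lambda>\<^sub>v|\<close>,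
  \<open>|\<lambda>\<^bsub>v+1\<^esub>|\<close>. In each case \<open>c\<^sub>v X\<^sub>v = O(1)\<close>, so \<open>k - 1\<close> of the \<open>k\<close>
  factors \<open>c\<^sub>v\<close> turn into \<open>X\<^sub>v\<^bsup>-(k-1)\<^esup>\<close>. A second Abel summation then moves the
  differences onto \<open>c\<close>, and the hypotheses on \<open>t\<close> bound the partial sums by \<open>O(X\<^sub>v)\<close>. The
  argument closes if \<open>\<Sum> X\<^sub>v |\<Delta>c\<^sub>v|\<close> converges
  (\<open>sum_powr_factor_bound\<close>).

  For the three choices of \<open>c\<close> this comes down to \<open>n X\<^sub>n |\<Delta>\<lambda>\<^sub>n| = O(1)\<close> and
  \<open>\<Sum> X\<^sub>n |\<Delta>\<lambda>\<^sub>n| < \<infinity>\<close>. Both follow from the conditions on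
  \<open>\<lambda>\<close> and two properties of \<open>X\<close>: up to constants, \<open>n X\<^sub>n\<close> is increasing and
  \<open>X\<^sub>1 + \<dots> + X\<^sub>n\<close> is at most \<open>n X\<^sub>n\<close>. This is where the exponent of a
  quasi-power-increasing sequence has to be less than 1; the logarithm is absorbed by a slightly
  larger power. The bound on \<open>n X\<^sub>n |\<Delta>\<lambda>\<^sub>n|\<close> is obtained by comparing
  \<open>n \<Delta>\<lambda>\<^sub>n\<close> with \<open>\<lambda>\<^sub>n - \<lambda>\<^bsub>2n\<^esub>\<close>
  (\<open>fwd_diff_weighted_bound\<close>).
\<close>

section \<open>Quasi-power-increasing sequences\<close>

text \<open>
  With \<open>r = n/m\<close> one has \<open>ln n = ln m + ln r\<close>; as \<open>ln m \<ge> ln 2\<close>, the quotient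
  \<open>ln n / ln m\<close> is at most \<open>1 + ln r / ln 2\<close>, which any positive power of \<open>r\<close>
  dominates.
\<close>
lemma ln_powr_ratio_le:
  fixes \<beta> \<epsilon> :: real
  assumes "\<beta> \<ge> 0" "\<epsilon> > 0"
  obtains C where "C > 0"
    and "\<And>m n :: nat. 2 \<le> m \<Longrightarrow> m \<le> n \<Longrightarrow>
           ln (real n) powr \<beta> \<le> C * (real n / real m) powr \<epsilon> * ln (real m) powr \<beta>"
proof (cases "\<beta> = 0")
  case True
  have "ln (real n) powr \<beta> \<le> 1 * (real n / real m) powr \<epsilon> * ln (real m) powr \<beta>"
    if "2 \<le> m" "m \<le> n" for m n :: nat
    using that True assms by (simp add: ge_one_powr_ge_zero)
  then show ?thesis by (rule that[of 1, rotated]) auto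
next
  case False
  then have "\<beta> > 0" using assms by simp
  define \<delta> where "\<delta> = \<epsilon> / \<beta>"
  have "\<delta> > 0" using \<open>\<beta> > 0\<close> assms by (simp add: \<delta>_def)
  define D where "D = 1 + 1 / (\<delta> * ln 2)"
  have "D > 0" unfolding D_def using \<open>\<delta> > 0\<close> by (intro add_pos_nonneg) auto
  have "ln (real n) powr \<beta> \<le> D powr \<beta> * (real n / real m) powr \<epsilon> * ln (real m) powr \<beta>"
    if mn: "2 \<le> m" "m \<le> n" for m n :: nat
  proof -
    define r where "r = real n / real m"
    have r: "r \<ge> 1" using mn by (simp add: r_def)
    have lnm: "ln 2 \<le> ln (real m)" using mn by simp
    have ln2: "ln (2::real) > 0" by simp
    have "ln (real n) = ln (real m) * 1 + ln r"
      using mn by (simp add: r_def ln_div)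
    also have "ln r \<le> ln (real m) / ln 2 * (r powr \<delta> / \<delta>)"
    proof -
      have "ln r \<le> 1 * (r powr \<delta> / \<delta>)" using ln_powr_bound[OF r \<open>\<delta> > 0\<close>] by simp
      also have "\<dots> \<le> ln (real m) / ln 2 * (r powr \<delta> / \<delta>)"
        using lnm ln2 \<open>\<delta> > 0\<close> by (intro mult_right_mono) (auto simp: field_simps)
      finally show ?thesis .
    qed
    also have "ln (real m) * 1 \<le> ln (real m) * r powr \<delta>"
      using r \<open>\<delta> > 0\<close> mn by (intro mult_left_mono) (auto simp: ge_one_powr_ge_zero)
    finally have "ln (real n) \<le> D * r powr \<delta> * ln (real m)"
      by (simp add: D_def field_simps)
    then have "ln (real n) powr \<beta> \<le> (D * r powr \<delta> * ln (real m)) powr \<beta>"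
      using mn \<open>\<beta> > 0\<close> by (intro powr_mono2) auto
    also have "\<dots> = D powr \<beta> * r powr (\<delta> * \<beta>) * ln (real m) powr \<beta>"
      using \<open>D > 0\<close> lnm ln2 r by (simp add: powr_mult powr_powr)
    also have "\<delta> * \<beta> = \<epsilon>" using \<open>\<beta> > 0\<close> by (simp add: \<delta>_def)
    finally show ?thesis by (simp add: r_def)
  qed
  then show ?thesis using \<open>D > 0\<close> by (intro that[of "D powr \<beta>"]) auto
qed

text \<open>
  The quotient of \<open>n\<^sup>\<tau>\<close> and \<open>n\<^sup>\<sigma> (log n)\<^sup>\<beta>\<close> is itself increasing up to a
  constant, so the logarithm costs only an arbitrarily small loss in the exponent.
\<close>
lemma quasi_power_increasing_absorb_log:
  fixes \<beta> \<sigma> \<tau> :: real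
  assumes "\<beta> \<ge> 0" "\<sigma> < \<tau>" and qp: "quasi_power_increasing (pow_log \<sigma> \<beta>) X"
  shows "quasi_power_increasing (pow_log \<tau> 0) X"
proof -
  from qp have pos: "X n > 0" if "n \<ge> 1" for n
    using that by (auto simp: quasi_power_increasing_def)
  from qp obtain K where K: "K \<ge> 1"
    and mono: "\<And>m n. 1 \<le> m \<Longrightarrow> m \<le> n \<Longrightarrow> pow_log \<sigma> \<beta> m * X m \<le> K * pow_log \<sigma> \<beta> n * X n"
    by (auto simp: quasi_power_increasing_def)
  obtain C where C: "C > 0" and lnC: "\<And>m n :: nat. 2 \<le> m \<Longrightarrow> m \<le> n \<Longrightarrow>
           ln (real n) powr \<beta> \<le> C * (real n / real m) powr (\<tau> - \<sigma>) * ln (real m) powr \<beta>"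
    using ln_powr_ratio_le[of \<beta> "\<tau> - \<sigma>"] assms by auto
  define L where "L n = (if \<beta> = 0 then 1 else ln (real n) powr \<beta>)" for n :: nat
  have step: "real m powr \<tau> * X m \<le> K * C * (real n powr \<tau> * X n)"
    if mn: "2 \<le> m" "m \<le> n" for m n
  proof -
    have Lm: "L m > 0" and Ln: "L n \<le> C * (real n / real m) powr (\<tau> - \<sigma>) * L m"
      using mn lnC[OF mn] by (auto simp: L_def)
    have "L m * (real m powr \<tau> * X m) = real m powr (\<tau> - \<sigma>) * (pow_log \<sigma> \<beta> m * X m)"
      using mn by (simp add: pow_log_def L_def powr_diff)
    also have "\<dots> \<le> real m powr (\<tau> - \<sigma>) * (K * pow_log \<sigma> \<beta> n * X n)"
      using mn by (intro mult_left_mono mono) auto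
    also have "\<dots> = real m powr (\<tau> - \<sigma>) * K * real n powr \<sigma> * X n * L n"
      by (simp add: pow_log_def L_def)
    also have "\<dots> \<le> real m powr (\<tau> - \<sigma>) * K * real n powr \<sigma> * X n *
                       (C * (real n / real m) powr (\<tau> - \<sigma>) * L m)"
      using K pos[of n] mn by (intro mult_left_mono Ln) auto
    also have "\<dots> = L m * (K * C * (real n powr \<tau> * X n))"
      using mn by (simp add: powr_divide powr_diff)
    finally show ?thesis using Lm by (rule mult_left_le_imp_le)
  qed
  \<comment> \<open>For \<open>\<beta> > 0\<close> the sequence \<open>f\<close> vanishes at index 1, so beyond positivity the hypothesis says
    nothing about \<open>X 1\<close>. The constant \<open>Q\<close> compares it with index 2.\<close>
  have X2: "2 powr \<tau> * X 2 > 0" using pos[of 2] by simp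
  define Q where "Q = X 1 / (2 powr \<tau> * X 2)"
  have Q: "Q > 0" unfolding Q_def using X2 pos[of 1] by (intro divide_pos_pos) auto
  define M where "M = 1 + K * C + Q * (K * C)"
  have KC: "K * C > 0" using K C by simp
  have M: "M \<ge> 1" "M \<ge> K * C" "M \<ge> Q * (K * C)"
    using KC Q by (auto simp: M_def)
  have "real m powr \<tau> * X m \<le> M * (real n powr \<tau> * X n)" if mn: "1 \<le> m" "m \<le> n" for m n
  proof -
    have nn: "real n powr \<tau> * X n \<ge> 0" using pos[of n] mn by simp
    consider "m \<ge> 2" | "m = 1" "n = 1" | "m = 1" "n \<ge> 2" using mn by linarith
    then show ?thesis
    proof cases
      case 1
      show ?thesis using step[OF 1 mn(2)] mult_right_mono[OF M(2) nn] by linarith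
    next
      case 2
      then show ?thesis using mult_right_mono[OF M(1) nn] by simp
    next
      case 3
      have "real m powr \<tau> * X m = Q * (2 powr \<tau> * X 2)"
        using pos[of 2] 3 by (simp add: Q_def)
      also have "\<dots> \<le> Q * (K * C * (real n powr \<tau> * X n))"
        using step[of 2 n] 3 Q by (intro mult_left_mono) auto
      also have "\<dots> \<le> M * (real n powr \<tau> * X n)"
        using mult_right_mono[OF M(3) nn] by (simp add: mult.assoc)
      finally show ?thesis .
    qed
  qed
  then have "\<exists>K\<ge>1. \<forall>m n. 1 \<le> m \<and> m \<le> n \<longrightarrow>
      K * pow_log \<tau> 0 n * X n \<ge> pow_log \<tau> 0 m * X m"
    using M(1) by (intro exI[of _ M]) (auto simp: pow_log_def mult.assoc)
  then show ?thesis using pos by (simp add: quasi_power_increasing_def)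
qed

text \<open>
  By induction: the increment of \<open>v\<^bsup>1-\<tau>\<^esup>\<close> is at least \<open>1 - \<tau>\<close> times the new
  summand. This is Bernoulli's inequality for the exponent \<open>1 - \<tau>\<close>, an instance of
  Young's inequality.
\<close>
lemma sum_powr_minus_le:
  fixes \<tau> :: real
  assumes "0 < \<tau>" "\<tau> < 1"
  shows "(\<Sum>n=1..v. real n powr (-\<tau>)) \<le> real v powr (1 - \<tau>) / (1 - \<tau>)"
proof (induction v)
  case 0
  then show ?case by simp
next
  case (Suc v)
  have inc: "real v powr (1 - \<tau>) + (1 - \<tau>) * real (Suc v) powr (-\<tau>) \<le> real (Suc v) powr (1 - \<tau>)"
  proof (cases "v = 0")
    case True
    then show ?thesis using assms by simp
  next
    case False
    define N where "N = real (Suc v)"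
    have N: "N > 0" "real v = N - 1" "real v > 0" using False by (auto simp: N_def)
    have "(real v / N) powr (1 - \<tau>) * 1 powr \<tau> \<le> (1 - \<tau>) * (real v / N) + \<tau> * 1"
      using assms N by (intro Youngs_inequality_0) auto
    then have "real v powr (1 - \<tau>) / N powr (1 - \<tau>) \<le> 1 - (1 - \<tau>) / N"
      using N(1,3) by (simp add: powr_divide N(2) field_simps)
    then have "real v powr (1 - \<tau>) \<le> (1 - (1 - \<tau>) / N) * N powr (1 - \<tau>)"
      using N by (simp add: pos_divide_le_eq)
    also have "\<dots> = N powr (1 - \<tau>) - (1 - \<tau>) * (N powr (1 - \<tau>) / N)"
      by (simp add: algebra_simps diff_divide_distrib)
    also have "N powr (1 - \<tau>) / N = N powr (- \<tau>)"
      using N by (simp add: powr_diff powr_minus field_simps)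
    finally show ?thesis by (simp add: N_def)
  qed
  have "(\<Sum>n=1..Suc v. real n powr (-\<tau>)) \<le>
      (real v powr (1 - \<tau>) + (1 - \<tau>) * real (Suc v) powr (-\<tau>)) / (1 - \<tau>)"
    using Suc.IH assms by (simp add: field_simps)
  also have "\<dots> \<le> real (Suc v) powr (1 - \<tau>) / (1 - \<tau>)"
    using inc assms by (intro divide_right_mono) auto
  finally show ?case .
qed

text \<open>
  Everything the proof uses about the growth of \<open>X\<close>. The second bound compares \<open>X\<^sub>m\<close> with
  \<open>(n/m)\<^sup>\<tau> X\<^sub>n\<close> and sums over \<open>m\<close>; it needs \<open>\<tau> < 1\<close>.
\<close>
lemma quasi_power_increasing_bounds:
  fixes \<tau> :: real
  assumes "0 < \<tau>" "\<tau> < 1" and qp: "quasi_power_increasing (pow_log \<tau> 0) X"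
  obtains C where "C \<ge> 1"
    and "\<And>m n. 1 \<le> m \<Longrightarrow> m \<le> n \<Longrightarrow> real m * X m \<le> C * (real n * X n)"
    and "\<And>n. 1 \<le> n \<Longrightarrow> (\<Sum>m=1..n. X m) \<le> C * (real n * X n)"
proof -
  from qp have pos: "X n > 0" if "n \<ge> 1" for n
    using that by (auto simp: quasi_power_increasing_def)
  from qp obtain K where K: "K \<ge> 1"
    and mono: "\<And>m n. 1 \<le> m \<Longrightarrow> m \<le> n \<Longrightarrow> real m powr \<tau> * X m \<le> K * (real n powr \<tau> * X n)"
    by (auto simp: quasi_power_increasing_def pow_log_def mult.assoc)
  have split: "x * y = x powr (1 - \<tau>) * (x powr \<tau> * y)" if "x > 0" for x y :: real
    using that by (simp flip: powr_add mult.assoc)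
  define C where "C = K / (1 - \<tau>)"
  have KC: "K \<le> C" using assms K by (simp add: C_def field_simps mult_left_le)
  show ?thesis
  proof (rule that[of C])
    show "C \<ge> 1" using KC K by simp
  next
    fix m n :: nat assume mn: "1 \<le> m" "m \<le> n"
    have "real m * X m = real m powr (1 - \<tau>) * (real m powr \<tau> * X m)"
      using mn by (intro split) auto
    also have "\<dots> \<le> real n powr (1 - \<tau>) * (K * (real n powr \<tau> * X n))"
      using mn assms pos[of m] by (intro mult_mono mono powr_mono2) auto
    also have "\<dots> = K * (real n * X n)"
      using mn by (simp add: split[of "real n" "X n"])
    also have "\<dots> \<le> C * (real n * X n)"
      using KC mn pos[of n] by (intro mult_right_mono) auto
    finally show "real m * X m \<le> C * (real n * X n)" .
  next
    fix n :: nat assume n: "1 \<le> n"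
    have "(\<Sum>m=1..n. X m) \<le> (\<Sum>m=1..n. real m powr (-\<tau>) * (K * (real n powr \<tau> * X n)))"
    proof (rule sum_mono)
      fix m assume m: "m \<in> {1..n}"
      have "X m = real m powr (-\<tau>) * (real m powr \<tau> * X m)"
        using m by (simp add: powr_minus)
      also have "\<dots> \<le> real m powr (-\<tau>) * (K * (real n powr \<tau> * X n))"
        using m by (intro mult_left_mono mono) auto
      finally show "X m \<le> real m powr (-\<tau>) * (K * (real n powr \<tau> * X n))" .
    qed
    also have "\<dots> = (\<Sum>m=1..n. real m powr (-\<tau>)) * (K * (real n powr \<tau> * X n))"
      by (simp add: sum_distrib_right)
    also have "\<dots> \<le> real n powr (1 - \<tau>) / (1 - \<tau>) * (K * (real n powr \<tau> * X n))"
      using K pos[OF n] by (intro mult_right_mono sum_powr_minus_le assms) auto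
    also have "\<dots> = C * (real n * X n)"
      using n by (simp add: C_def split[of "real n" "X n"])
    finally show "(\<Sum>m=1..n. X m) \<le> C * (real n * X n)" .
  qed
qed

section \<open>The factor sequence and its differences\<close>

lemma fwd_diff_telescope: "m \<le> n \<Longrightarrow> (\<Sum>i=m..<n. fwd_diff u i) = u m - u n"
  by (induction n rule: dec_induct) (auto simp: fwd_diff_def)

lemma norm_diff_le_sum_fwd_diff:
  fixes u :: "nat \<Rightarrow> 'a::real_normed_vector"
  assumes "m \<le> n"
  shows "norm (u m - u n) \<le> (\<Sum>i=m..<n. norm (fwd_diff u i))"
  using norm_sum[of "fwd_diff u" "{m..<n}"] fwd_diff_telescope[OF assms, of u] by simp

text \<open>
  Write \<open>n \<Delta>\<lambda>\<^sub>n\<close> as the sum \<open>\<lambda>\<^sub>n - \<lambda>\<^bsub>2n\<^esub>\<close> of the differences over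
  \<open>n \<le> i < 2n\<close>, plus the corrections \<open>\<Delta>\<lambda>\<^sub>n - \<Delta>\<lambda>\<^sub>i\<close>. The bound
  on \<open>\<lambda> X\<close> controls the first part and the bound on second differences controls the
  corrections. Comparing with \<open>2n\<close> rather than with infinity makes it unnecessary to know
  beforehand that \<open>\<Delta>\<lambda>\<^sub>n\<close> tends to 0.
\<close>
lemma fwd_diff_weighted_bound:
  fixes lam :: "nat \<Rightarrow> 'a::real_normed_vector" and X :: "nat \<Rightarrow> real"
  assumes pos: "\<And>n. n \<ge> 1 \<Longrightarrow> X n > 0"
    and C: "C \<ge> 0" "\<And>m n. 1 \<le> m \<Longrightarrow> m \<le> n \<Longrightarrow> real m * X m \<le> C * (real n * X n)"
    and L: "\<And>n. n \<ge> 1 \<Longrightarrow> X n * norm (lam n) \<le> L"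
    and B: "\<And>m. (\<Sum>n=1..m. real n * X n * norm (fwd_diff (fwd_diff lam) n)) \<le> B"
    and n: "n \<ge> 1"
  shows "real n * X n * norm (fwd_diff lam n) \<le> L + 2 * C * L + C * B"
proof -
  define d where "d = fwd_diff lam"
  have close: "real n * X n * norm (d n - d i) \<le> C * B" if i: "n \<le> i" for i
  proof -
    have "real n * X n * norm (d n - d i) \<le> real n * X n * (\<Sum>j=n..<i. norm (fwd_diff d j))"
      using n pos[OF n] by (intro mult_left_mono norm_diff_le_sum_fwd_diff i) auto
    also have "\<dots> = (\<Sum>j=n..<i. real n * X n * norm (fwd_diff d j))"
      by (rule sum_distrib_left)
    also have "\<dots> \<le> (\<Sum>j=n..<i. C * (real j * X j) * norm (fwd_diff d j))"
      using n by (intro sum_mono mult_right_mono C(2)) auto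
    also have "\<dots> = C * (\<Sum>j=n..<i. real j * X j * norm (fwd_diff d j))"
      by (simp add: sum_distrib_left mult_ac)
    also have "\<dots> \<le> C * (\<Sum>j=1..i. real j * X j * norm (fwd_diff d j))"
      using n pos C(1)
      by (intro mult_left_mono sum_mono2 mult_nonneg_nonneg) (auto simp: less_imp_le)
    also have "\<dots> \<le> C * B" using B[of i] C(1) by (intro mult_left_mono) (auto simp: d_def)
    finally show ?thesis .
  qed
  have "(\<Sum>i=n..<2*n. d i) = lam n - lam (2 * n)"
    unfolding d_def by (rule fwd_diff_telescope) simp
  moreover have "(\<Sum>i=n..<2*n. d n) = real n *\<^sub>R d n"
    by (simp add: sum_constant_scaleR)
  ultimately have "real n *\<^sub>R d n = (lam n - lam (2 * n)) + (\<Sum>i=n..<2*n. d n - d i)"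
    by (simp add: sum_subtractf)
  then have "real n * norm (d n) = norm ((lam n - lam (2 * n)) + (\<Sum>i=n..<2*n. d n - d i))"
    by (metis norm_scaleR abs_of_nat)
  also have "\<dots> \<le> norm (lam n) + norm (lam (2 * n)) + (\<Sum>i=n..<2*n. norm (d n - d i))"
    by (intro order.trans[OF norm_triangle_ineq] add_mono norm_triangle_ineq4 norm_sum)
  finally have "X n * (real n * norm (d n)) \<le>
      X n * (norm (lam n) + norm (lam (2 * n)) + (\<Sum>i=n..<2*n. norm (d n - d i)))"
    using pos[OF n] by (intro mult_left_mono) auto
  also have "\<dots> = X n * norm (lam n) + X n * norm (lam (2 * n))
                  + (\<Sum>i=n..<2*n. X n * norm (d n - d i))"
    by (simp add: distrib_left sum_distrib_left)
  also have "X n * norm (lam n) \<le> L" by (rule L[OF n])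
  also have "X n * norm (lam (2 * n)) \<le> 2 * C * L"
  proof -
    have "real n * X n \<le> real n * (2 * C * X (2 * n))"
      using C(2)[OF n, of "2 * n"] by (simp add: mult_ac)
    then have "X n \<le> 2 * C * X (2 * n)" using n by simp
    then have "X n * norm (lam (2 * n)) \<le> 2 * C * X (2 * n) * norm (lam (2 * n))"
      by (intro mult_right_mono) auto
    also have "\<dots> = 2 * C * (X (2 * n) * norm (lam (2 * n)))" by simp
    also have "\<dots> \<le> 2 * C * L" using L[of "2 * n"] n C(1) by (intro mult_left_mono) auto
    finally show ?thesis .
  qed
  also have "(\<Sum>i=n..<2*n. X n * norm (d n - d i)) \<le> (\<Sum>i=n..<2*n. C * B / real n)"
    using close n by (intro sum_mono) (auto simp: field_simps)
  also have "\<dots> = C * B" using n by simp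
  finally show ?thesis by (simp add: d_def mult_ac)
qed

text \<open>
  Bound each first difference by the last one plus the second differences in between, and exchange
  the order of summation: the second difference at \<open>v\<close> is then counted with weight
  \<open>X\<^sub>1 + \<dots> + X\<^sub>v\<close>, which is at most \<open>C v X\<^sub>v\<close>.
\<close>
lemma sum_fwd_diff_weighted_bound:
  fixes lam :: "nat \<Rightarrow> 'a::real_normed_vector" and X :: "nat \<Rightarrow> real"
  assumes pos: "\<And>n. n \<ge> 1 \<Longrightarrow> X n > 0"
    and C: "C \<ge> 0" "\<And>m n. 1 \<le> m \<Longrightarrow> m \<le> n \<Longrightarrow> real m * X m \<le> C * (real n * X n)"
    and S: "\<And>n. 1 \<le> n \<Longrightarrow> (\<Sum>m=1..n. X m) \<le> C * (real n * X n)"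
    and B: "\<And>m. (\<Sum>n=1..m. real n * X n * norm (fwd_diff (fwd_diff lam) n)) \<le> B"
    and G: "\<And>n. n \<ge> 1 \<Longrightarrow> real n * X n * norm (fwd_diff lam n) \<le> G"
  shows "(\<Sum>n=1..m. X n * norm (fwd_diff lam n)) \<le> C * (B + G)"
proof (cases "m = 0")
  case True
  have "B \<ge> 0" using B[of 0] by simp
  moreover have "G \<ge> 0" using G[of 1] pos[of 1] by (smt (verit) mult_nonneg_nonneg norm_ge_zero of_nat_0_le_iff order_refl)
  ultimately show ?thesis using True C(1) by simp
next
  case False
  then have m: "m \<ge> 1" by simp
  define d where "d = fwd_diff lam"
  define e where "e n = norm (fwd_diff d n)" for n
  have e_nonneg: "e n \<ge> 0" for n by (simp add: e_def)
  have d_le: "norm (d n) \<le> norm (d m) + (\<Sum>v=n..<m. e v)" if "n \<le> m" for n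
  proof -
    have "norm (d n) \<le> norm (d m) + norm (d n - d m)" by (metis norm_triangle_sub)
    also have "norm (d n - d m) \<le> (\<Sum>v=n..<m. e v)"
      unfolding e_def by (rule norm_diff_le_sum_fwd_diff[OF that])
    finally show ?thesis by simp
  qed
  have "(\<Sum>n=1..m. X n * norm (d n)) \<le> (\<Sum>n=1..m. X n * (norm (d m) + (\<Sum>v=n..<m. e v)))"
    using pos by (intro sum_mono mult_left_mono d_le) (auto simp: less_imp_le)
  also have "\<dots> = (\<Sum>n=1..m. X n) * norm (d m) + (\<Sum>n=1..m. \<Sum>v=n..<m. X n * e v)"
    by (simp add: distrib_left sum.distrib sum_distrib_left sum_distrib_right)
  \<comment> \<open>Exchange of the order of summation over the pairs \<open>n \<le> v < m\<close>.\<close>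
  also have "(\<Sum>n=1..m. \<Sum>v=n..<m. X n * e v) = (\<Sum>v=1..<m. \<Sum>n=1..v. X n * e v)"
    unfolding sum.Sigma[OF finite_atLeastAtMost ballI[OF finite_atLeastLessThan]]
              sum.Sigma[OF finite_atLeastLessThan ballI[OF finite_atLeastAtMost]]
    by (rule sum.reindex_bij_witness[where i = prod.swap and j = prod.swap]) auto
  also have "\<dots> = (\<Sum>v=1..<m. (\<Sum>n=1..v. X n) * e v)"
    by (simp add: sum_distrib_right)
  also have "\<dots> \<le> (\<Sum>v=1..<m. C * (real v * X v) * e v)"
    using e_nonneg by (intro sum_mono mult_right_mono S) auto
  also have "\<dots> = C * (\<Sum>v=1..<m. real v * X v * e v)"
    by (simp add: sum_distrib_left mult_ac)
  also have "(\<Sum>v=1..<m. real v * X v * e v) \<le> (\<Sum>v=1..m. real v * X v * e v)"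
    using e_nonneg pos by (intro sum_mono2 mult_nonneg_nonneg) (auto simp: less_imp_le)
  also have "\<dots> \<le> B" using B[of m] by (simp add: e_def d_def)
  also have "(\<Sum>n=1..m. X n) * norm (d m) \<le> C * (real m * X m) * norm (d m)"
    by (intro mult_right_mono S m) auto
  also have "\<dots> = C * (real m * X m * norm (d m))" by (simp add: mult_ac)
  also have "\<dots> \<le> C * G" using G[OF m] C(1) by (intro mult_left_mono) (auto simp: d_def)
  finally show ?thesis using C(1) by (simp add: d_def distrib_left mult_left_mono)
qed

lemma abs_index_mult_norm_diff_le:
  fixes u :: "nat \<Rightarrow> 'a::real_normed_vector"
  shows "\<bar>real n * norm (u n) - real (Suc n) * norm (u (Suc n))\<bar>
    \<le> real n * norm (fwd_diff u n) + norm (u (Suc n))"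
proof -
  have "\<bar>real n * norm (u n) - real (Suc n) * norm (u (Suc n))\<bar>
      = \<bar>real n * (norm (u n) - norm (u (Suc n))) - norm (u (Suc n))\<bar>"
    by (simp add: algebra_simps)
  also have "\<dots> \<le> real n * \<bar>norm (u n) - norm (u (Suc n))\<bar> + norm (u (Suc n))"
    by (rule order.trans[OF abs_triangle_ineq4]) (simp add: abs_mult)
  also have "\<dots> \<le> real n * norm (fwd_diff u n) + norm (u (Suc n))"
    using norm_triangle_ineq3[of "u n" "u (Suc n)"]
    by (intro add_right_mono mult_left_mono) (simp_all add: fwd_diff_def)
  finally show ?thesis .
qed

section \<open>Summation against a factor of bounded variation\<close>

text \<open>
  Abel summation with partial sums of \<open>w\<close> of order \<open>X\<close>: \<open>E\<close> pays for the
  differences of \<open>c\<close> and \<open>F\<close> for the boundary term.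
\<close>
lemma abs_summation_by_parts_bound:
  fixes c w X :: "nat \<Rightarrow> real"
  assumes w: "\<And>n. n \<ge> 1 \<Longrightarrow> w n \<ge> 0" and c: "\<And>n. n \<ge> 1 \<Longrightarrow> c n \<ge> 0"
    and D: "D \<ge> 0" "\<And>m. m \<ge> 1 \<Longrightarrow> (\<Sum>n=1..m. w n) \<le> D * X m"
    and E: "\<And>m. (\<Sum>n=1..m. X n * \<bar>c n - c (Suc n)\<bar>) \<le> E"
    and F: "\<And>m. m \<ge> 1 \<Longrightarrow> c m * X m \<le> F"
  shows "(\<Sum>n=1..m. c n * w n) \<le> D * (E + F)"
proof -
  define S where "S m = (\<Sum>n=1..m. w n)" for m
  have S_nonneg: "S m \<ge> 0" for m unfolding S_def by (intro sum_nonneg w) auto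
  have "(\<Sum>n=1..m. c n * w n) = (\<Sum>n=1..m. (c n - c (Suc n)) * S n) + c (Suc m) * S m"
    by (induction m) (auto simp: S_def algebra_simps)
  also have "(\<Sum>n=1..m. (c n - c (Suc n)) * S n) \<le> (\<Sum>n=1..m. D * (X n * \<bar>c n - c (Suc n)\<bar>))"
  proof (rule sum_mono)
    fix n assume n: "n \<in> {1..m}"
    have "(c n - c (Suc n)) * S n \<le> \<bar>c n - c (Suc n)\<bar> * (D * X n)"
      using n S_nonneg D(2)[of n] by (intro mult_mono) (auto simp: S_def)
    then show "(c n - c (Suc n)) * S n \<le> D * (X n * \<bar>c n - c (Suc n)\<bar>)"
      by (simp add: mult_ac)
  qed
  also have "\<dots> \<le> D * E"
    using E[of m] D(1) by (simp add: sum_distrib_left[symmetric] mult_left_mono)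
  \<comment> \<open>The boundary factor carries index \<open>m + 1\<close>; as \<open>w\<close> is nonnegative, \<open>S m\<close> may be replaced by
    \<open>S (m + 1)\<close>, so that \<open>c\<close> and \<open>X\<close> meet at the same index.\<close>
  also have "c (Suc m) * S m \<le> D * F"
  proof -
    have "S m \<le> S (Suc m)" using w[of "Suc m"] by (simp add: S_def)
    also have "\<dots> \<le> D * X (Suc m)" using D(2)[of "Suc m"] by (simp add: S_def)
    finally have "c (Suc m) * S m \<le> c (Suc m) * (D * X (Suc m))"
      using c[of "Suc m"] by (intro mult_left_mono) auto
    also have "\<dots> = D * (c (Suc m) * X (Suc m))" by (simp add: mult_ac)
    also have "\<dots> \<le> D * F" using F[of "Suc m"] D(1) by (intro mult_left_mono) auto
    finally show ?thesis .
  qed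
  finally show ?thesis by (simp add: distrib_left)
qed

text \<open>
  Of the \<open>k\<close> factors \<open>c\<close>, all but one are replaced by their bound \<open>F/X\<close>.
\<close>
lemma powr_split_off_factor:
  fixes k :: real
  assumes k: "k \<ge> 1" and x: "x \<ge> 0" and c: "c \<ge> 0" "X > 0" "c * X \<le> F"
  shows "(c * x) powr k \<le> F powr (k - 1) * (c * (x powr k / X powr (k - 1)))"
proof -
  have "c powr k = c powr (k - 1) * c"
    using c(1) k powr_mult_base[of c "k - 1"] by (simp add: mult.commute)
  also have "\<dots> \<le> (F / X) powr (k - 1) * c"
    using c k by (intro mult_right_mono powr_mono2) (auto simp: field_simps)
  finally have "c powr k \<le> F powr (k - 1) * c / X powr (k - 1)"
    using c by (simp add: powr_divide)
  then have "c powr k * x powr k \<le> F powr (k - 1) * c / X powr (k - 1) * x powr k"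
    by (intro mult_right_mono) auto
  then show ?thesis using c x by (simp add: powr_mult)
qed

text \<open>
  The hypotheses on \<open>t\<close> in the main theorem have the form of assumption \<open>D\<close>; the
  conclusion allows an arbitrary factor \<open>c\<close> of order \<open>1/X\<close> whose variation, weighted
  by \<open>X\<close>, is bounded.
\<close>
lemma sum_powr_factor_bound:
  fixes c g x X :: "nat \<Rightarrow> real" and k :: real
  assumes k: "k \<ge> 1" and pos: "\<And>n. n \<ge> 1 \<Longrightarrow> X n > 0"
    and g: "\<And>n. n \<ge> 1 \<Longrightarrow> g n \<ge> 0" and x: "\<And>n. n \<ge> 1 \<Longrightarrow> x n \<ge> 0"
    and c: "\<And>n. n \<ge> 1 \<Longrightarrow> c n \<ge> 0"
    and D: "D \<ge> 0" "\<And>m. m \<ge> 1 \<Longrightarrow> (\<Sum>n=1..m. g n * (x n powr k / X n powr (k - 1))) \<le> D * X m"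
    and E: "\<And>m. (\<Sum>n=1..m. X n * \<bar>c n - c (Suc n)\<bar>) \<le> E"
    and F: "\<And>m. m \<ge> 1 \<Longrightarrow> c m * X m \<le> F"
  shows "(\<Sum>n=1..m. g n * (c n * x n) powr k) \<le> F powr (k - 1) * (D * (E + F))"
proof -
  have "(\<Sum>n=1..m. g n * (c n * x n) powr k)
      \<le> (\<Sum>n=1..m. g n * (F powr (k - 1) * (c n * (x n powr k / X n powr (k - 1)))))"
    using k g x c F pos by (intro sum_mono mult_left_mono powr_split_off_factor) auto
  also have "\<dots> = F powr (k - 1) * (\<Sum>n=1..m. c n * (g n * (x n powr k / X n powr (k - 1))))"
    by (simp add: sum_distrib_left mult_ac)
  also have "\<dots> \<le> F powr (k - 1) * (D * (E + F))"
    using pos g c D E F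
    by (intro mult_left_mono abs_summation_by_parts_bound[where X = X]) auto
  finally show ?thesis .
qed

section \<open>Kernels with bounded row and column sums\<close>

text \<open>
  Jensen's inequality for \<open>x\<^sup>k\<close>, freed from the normalisation of the weights. It is
  equally Hoelder's inequality for \<open>w\<^bsup>1-1/k\<^esup>\<close> and \<open>w\<^bsup>1/k\<^esup> x\<close>.
\<close>
lemma powr_sum_le_weighted:
  fixes k :: real and w x :: "'i \<Rightarrow> real"
  assumes k: "k \<ge> 1" and fin: "finite I"
    and w: "\<And>i. i \<in> I \<Longrightarrow> w i \<ge> 0" and x: "\<And>i. i \<in> I \<Longrightarrow> x i \<ge> 0"
  shows "(\<Sum>i\<in>I. w i * x i) powr k \<le> (\<Sum>i\<in>I. w i) powr (k - 1) * (\<Sum>i\<in>I. w i * x i powr k)"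
proof -
  \<comment> \<open>Convexity is used on the open half-line, and normalising the weights needs a positive total;
    both hold after discarding the vanishing summands.\<close>
  define J where "J = {i\<in>I. w i * x i \<noteq> 0}"
  have J: "finite J" "J \<subseteq> I" using fin by (auto simp: J_def)
  have pos: "w i > 0" "x i > 0" if "i \<in> J" for i
    using that w[of i] x[of i] by (auto simp: J_def)
  have eq: "(\<Sum>i\<in>I. w i * x i) = (\<Sum>i\<in>J. w i * x i)"
    using fin by (intro sum.mono_neutral_right) (auto simp: J_def)
  show ?thesis
  proof (cases "J = {}")
    case True
    then have "(\<Sum>i\<in>I. w i * x i) powr k = 0" using eq by simp
    also have "\<dots> \<le> (\<Sum>i\<in>I. w i) powr (k - 1) * (\<Sum>i\<in>I. w i * x i powr k)"
      using w by (intro mult_nonneg_nonneg sum_nonneg) auto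
    finally show ?thesis .
  next
    case False
    define W where "W = (\<Sum>i\<in>J. w i)"
    have W: "W > 0" unfolding W_def using False J pos by (intro sum_pos) auto
    have S: "(\<Sum>i\<in>J. w i * x i) \<ge> 0" using pos by (intro sum_nonneg) (auto simp: less_imp_le)
    have "(\<Sum>i\<in>J. (w i / W) *\<^sub>R x i) powr k \<le> (\<Sum>i\<in>J. (w i / W) * x i powr k)"
      using J False pos W
      by (intro convex_on_sum[where f = "\<lambda>x. x powr k", OF _ _ powr_convex[OF k]])
         (auto simp: W_def less_imp_le simp flip: sum_divide_distrib)
    then have "((\<Sum>i\<in>J. w i * x i) / W) powr k \<le> (\<Sum>i\<in>J. w i * x i powr k) / W"
      by (simp add: sum_divide_distrib)
    then have "(\<Sum>i\<in>J. w i * x i) powr k \<le> W powr k * ((\<Sum>i\<in>J. w i * x i powr k) / W)"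
      using W S by (simp add: powr_divide field_simps)
    also have "\<dots> = W powr (k - 1) * (\<Sum>i\<in>J. w i * x i powr k)"
      using W by (simp add: powr_diff)
    also have "\<dots> \<le> (\<Sum>i\<in>I. w i) powr (k - 1) * (\<Sum>i\<in>I. w i * x i powr k)"
      using J k W fin w x unfolding W_def
      by (intro mult_mono powr_mono2 sum_mono2 mult_nonneg_nonneg sum_nonneg)
         (auto dest: subsetD)
    finally show ?thesis unfolding eq .
  qed
qed

lemma powr_sum4_le:
  fixes k a b c d :: real
  assumes "k \<ge> 1" and nonneg: "a \<ge> 0" "b \<ge> 0" "c \<ge> 0" "d \<ge> 0"
  shows "(2 * (a + b + c + d)) powr k
    \<le> 8 powr (k - 1) * 2 * (a powr k + b powr k + c powr k + d powr k)"
proof -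
  define J where "J i = [a, b, c, d] ! i" for i
  have set4: "{..<4::nat} = {0, 1, 2, 3}" by auto
  have J: "J 0 = a" "J (Suc 0) = b" "J 2 = c" "J 3 = d"
    by (simp_all add: J_def eval_nat_numeral)
  have "(\<Sum>i<4. 2 * J i) powr k \<le> (\<Sum>i<4::nat. 2) powr (k - 1) * (\<Sum>i<4. 2 * J i powr k)"
    using assms(1) nonneg by (intro powr_sum_le_weighted) (auto simp: set4 J)
  then show ?thesis by (simp add: set4 J algebra_simps)
qed

text \<open>
  A weighted Schur test for a lower triangular kernel. Hoelder's inequality in row \<open>n\<close>
  produces the row sum to the power \<open>k - 1\<close>, which cancels the weight
  \<open>q\<^sub>n\<^bsup>k-1\<^esup>\<close>. In what is left the order of summation is exchanged and
  the column sums enter.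
\<close>
lemma sum_triangle_kernel_powr_bound:
  fixes b :: "nat \<Rightarrow> nat \<Rightarrow> real" and q g y :: "nat \<Rightarrow> real" and k :: real
  assumes k: "k \<ge> 1" and q: "\<And>n. q n > 0"
    and b: "\<And>n v. 1 \<le> v \<Longrightarrow> v < n \<Longrightarrow> b n v \<ge> 0" and y: "\<And>v. v \<ge> 1 \<Longrightarrow> y v \<ge> 0"
    and rows: "\<And>n. n \<ge> 1 \<Longrightarrow> (\<Sum>v=1..n-1. b n v) \<le> M / q n"
    and cols: "\<And>v m. v \<ge> 1 \<Longrightarrow> (\<Sum>n=Suc v..m. b n v) \<le> g v"
    and B: "\<And>m. (\<Sum>v=1..m. g v * y v powr k) \<le> B"
  shows "(\<Sum>n=1..m. q n powr (k - 1) * (\<Sum>v=1..n-1. b n v * y v) powr k) \<le> M powr (k - 1) * B"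
proof -
  have "(\<Sum>n=1..m. q n powr (k - 1) * (\<Sum>v=1..n-1. b n v * y v) powr k)
      \<le> (\<Sum>n=1..m. M powr (k - 1) * (\<Sum>v=1..n-1. b n v * y v powr k))"
  proof (rule sum_mono)
    fix n assume n: "n \<in> {1..m}"
    have nn: "(\<Sum>v=1..n-1. b n v) \<ge> 0" "(\<Sum>v=1..n-1. b n v * y v powr k) \<ge> 0"
      using b by (auto intro!: sum_nonneg)
    have "(\<Sum>v=1..n-1. b n v * y v) powr k
        \<le> (\<Sum>v=1..n-1. b n v) powr (k - 1) * (\<Sum>v=1..n-1. b n v * y v powr k)"
      using k b y by (intro powr_sum_le_weighted) auto
    also have "\<dots> \<le> (M / q n) powr (k - 1) * (\<Sum>v=1..n-1. b n v * y v powr k)"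
      using k n nn rows by (intro mult_right_mono powr_mono2) auto
    finally have "q n powr (k - 1) * (\<Sum>v=1..n-1. b n v * y v) powr k
        \<le> q n powr (k - 1) * ((M / q n) powr (k - 1) * (\<Sum>v=1..n-1. b n v * y v powr k))"
      by (intro mult_left_mono) auto
    also have "M / q n \<ge> 0" using nn(1) rows[of n] n by simp
    then have "q n powr (k - 1) * ((M / q n) powr (k - 1) * (\<Sum>v=1..n-1. b n v * y v powr k))
        = M powr (k - 1) * (\<Sum>v=1..n-1. b n v * y v powr k)"
      using q[of n] by (simp add: powr_divide zero_le_divide_iff)
    finally show "q n powr (k - 1) * (\<Sum>v=1..n-1. b n v * y v) powr k
        \<le> M powr (k - 1) * (\<Sum>v=1..n-1. b n v * y v powr k)" .
  qed
  also have "\<dots> = M powr (k - 1) * (\<Sum>n=1..m. \<Sum>v=1..n-1. b n v * y v powr k)"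
    by (simp add: sum_distrib_left)
  also have "(\<Sum>n=1..m. \<Sum>v=1..n-1. b n v * y v powr k) = (\<Sum>v=1..m. \<Sum>n=Suc v..m. b n v * y v powr k)"
    unfolding sum.Sigma[OF finite_atLeastAtMost ballI[OF finite_atLeastAtMost]]
    by (rule sum.reindex_bij_witness[where i = prod.swap and j = prod.swap]) auto
  also have "\<dots> = (\<Sum>v=1..m. (\<Sum>n=Suc v..m. b n v) * y v powr k)"
    by (simp add: sum_distrib_right)
  also have "M powr (k - 1) * \<dots> \<le> M powr (k - 1) * (\<Sum>v=1..m. g v * y v powr k)"
    using cols by (intro mult_left_mono sum_mono mult_right_mono) auto
  also have "\<dots> \<le> M powr (k - 1) * B" using B by (intro mult_left_mono) auto
  finally show ?thesis .
qed

section \<open>The matrices associated with a normal matrix\<close>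

text \<open>
  As every row of \<open>A\<close> sums to 1, the tail of a row is 1 minus its head. In this form the
  entries are visibly nonnegative when the columns of \<open>A\<close> decrease.
\<close>
lemma hat_matrix_Suc_eq_sum:
  assumes rows: "\<And>n. bar_matrix A n 0 = 1" and v: "v < n"
  shows "hat_matrix A n (Suc v) = (\<Sum>i=0..v. A (n - 1) i - A n i)"
proof -
  have "bar_matrix A m (Suc v) = 1 - (\<Sum>i=0..v. A m i)" if "v \<le> m" for m
    using rows[of m] sum.ub_add_nat[of 0 v "A m" "m - v"] that
    by (simp add: bar_matrix_def)
  from this[of n] this[of "n - 1"] v show ?thesis
    by (simp add: hat_matrix_def sum_subtractf)
qed

lemma hat_matrix_diff:
  assumes "1 \<le> n" "v < n"
  shows "hat_matrix A n v - hat_matrix A n (Suc v) = A n v - A (n - 1) v"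
  using assms by (simp add: hat_matrix_def bar_matrix_def sum.atLeast_Suc_atMost)

lemma hat_matrix_diag:
  assumes "n \<ge> 1"
  shows "hat_matrix A n n = A n n"
  using assms by (simp add: hat_matrix_def bar_matrix_def)

lemma hat_matrix_nonneg:
  assumes rows: "\<And>n. bar_matrix A n 0 = 1"
    and cols: "\<And>n v. n \<ge> v + 1 \<Longrightarrow> A (n - 1) v \<ge> A n v"
    and v: "v < n"
  shows "hat_matrix A n (Suc v) \<ge> 0"
  unfolding hat_matrix_Suc_eq_sum[OF rows v]
  using v cols[of _ n] by (intro sum_nonneg) simp

text \<open>
  Rows \<open>n - 1\<close> and \<open>n\<close> both sum to 1, so the total decrease over the first \<open>n\<close>
  columns equals the entry gained on the diagonal.
\<close>
lemma sum_row_decrease_le_diag: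
  assumes rows: "\<And>n. bar_matrix A n 0 = 1"
    and cols: "\<And>n v. n \<ge> v + 1 \<Longrightarrow> A (n - 1) v \<ge> A n v"
    and n: "n \<ge> 1"
  shows "(\<Sum>v=1..n-1. A (n - 1) v - A n v) \<le> A n n"
proof -
  obtain m where m: "n = Suc m" using n by (cases n) auto
  have "(\<Sum>v=1..n-1. A (n - 1) v - A n v) \<le> (\<Sum>v=0..n-1. A (n - 1) v - A n v)"
    using cols[of 0 n] m by (intro sum_mono2) (auto simp: not_less_eq_eq)
  also have "\<dots> = A n n"
    using rows[of m] rows[of "Suc m"] by (simp add: m bar_matrix_def sum_subtractf)
  finally show ?thesis .
qed

lemma sum_column_decrease_le_diag:
  assumes nonneg: "\<And>n v. v \<le> n \<Longrightarrow> A n v \<ge> 0"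
  shows "(\<Sum>n=Suc v..m. A (n - 1) v - A n v) \<le> (A v v :: real)"
proof (cases "v \<le> m")
  case True
  have "(\<Sum>n=Suc v..m. A (n - 1) v - A n v) = A v v - A m v"
    using True by (induction m rule: dec_induct) auto
  then show ?thesis using nonneg[OF True] by simp
qed (use nonneg[of v v] in simp)

text \<open>
  The sum telescopes to a single tail of a row of \<open>A\<close>, because
  \<open>bar_matrix A v (Suc v)\<close> is an empty sum.
\<close>
lemma sum_column_hat_matrix_le_one:
  assumes nonneg: "\<And>n v. v \<le> n \<Longrightarrow> A n v \<ge> 0" and rows: "\<And>n. bar_matrix A n 0 = 1"
  shows "(\<Sum>n=Suc v..m. hat_matrix A n (Suc v)) \<le> 1"
proof (cases "v \<le> m")
  case True
  have "(\<Sum>n=Suc v..m. hat_matrix A n (Suc v)) = bar_matrix A m (Suc v)"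
    using True by (induction m rule: dec_induct) (auto simp: hat_matrix_def bar_matrix_def)
  also have "\<dots> \<le> bar_matrix A m 0"
    unfolding bar_matrix_def using nonneg by (intro sum_mono2) auto
  finally show ?thesis using rows by simp
qed simp

lemma matrix_transform_psum:
  fixes c :: "nat \<Rightarrow> 'a::real_normed_vector"
  shows "matrix_transform A (psum c) n = (\<Sum>v=0..n. bar_matrix A n v *\<^sub>R c v)"
proof -
  have "matrix_transform A (psum c) n = (\<Sum>i=0..n. \<Sum>v=0..i. A n i *\<^sub>R c v)"
    by (simp add: matrix_transform_def psum_def scaleR_sum_right)
  also have "\<dots> = (\<Sum>v=0..n. \<Sum>i=v..n. A n i *\<^sub>R c v)"
    unfolding sum.Sigma[OF finite_atLeastAtMost ballI[OF finite_atLeastAtMost]]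
    by (rule sum.reindex_bij_witness[where i = prod.swap and j = prod.swap]) auto
  finally show ?thesis by (simp add: bar_matrix_def scaleR_sum_left)
qed

text \<open>
  This is why the matrix \<open>\<hat>A\<close> is introduced: it maps the terms of a series to the
  differences of the \<open>A\<close>-means of its partial sums.
\<close>
lemma matrix_transform_diff:
  fixes c :: "nat \<Rightarrow> 'a::real_normed_vector"
  assumes n: "n \<ge> 1"
  shows "matrix_transform A (psum c) n - matrix_transform A (psum c) (n - 1)
    = (\<Sum>v=0..n. hat_matrix A n v *\<^sub>R c v)"
proof -
  obtain m where m: "n = Suc m" using n by (cases n) auto
  have "(\<Sum>v=0..m. bar_matrix A m v *\<^sub>R c v) = (\<Sum>v=0..n. bar_matrix A m v *\<^sub>R c v)"
    by (simp add: m bar_matrix_def)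
  then show ?thesis
    by (simp add: matrix_transform_psum hat_matrix_def m scaleR_diff_left sum_subtractf)
qed

text \<open>
  Abel summation with \<open>v a\<^sub>v\<close> as the summed factor, whose partial sums are
  \<open>(v + 1) t\<^sub>v\<close>. The difference of
  \<open>\<hat>a\<^sub>n\<^sub>v \<lambda>\<^sub>v / v\<close> is resolved by the product rule into three parts,
  one for each of its factors.
\<close>
lemma sum_hat_matrix_by_parts:
  fixes a lam :: "nat \<Rightarrow> 'a::real_normed_field"
  assumes n: "n \<ge> 1"
  shows "(\<Sum>v=1..n. hat_matrix A n v *\<^sub>R (a v * lam v)) =
    ((real n + 1) / real n * A n n) *\<^sub>R (lam n * t_mean a n)
    + (\<Sum>v=1..n-1. ((real v + 1) / real v * (A n v - A (n - 1) v)) *\<^sub>R (lam v * t_mean a v)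
        + ((real v + 1) / real v * hat_matrix A n (Suc v)) *\<^sub>R (fwd_diff lam v * t_mean a v)
        + (hat_matrix A n (Suc v) / real v) *\<^sub>R (lam (Suc v) * t_mean a v))"
proof -
  define h where "h = hat_matrix A n"
  define T where "T m = (\<Sum>v=1..m. of_nat v * a v)" for m
  define g where "g v = (h v / real v) *\<^sub>R lam v" for v
  have T: "T v = (real v + 1) *\<^sub>R t_mean a v" for v
  proof -
    have "(of_nat (v + 1) :: 'a) \<noteq> 0" by (simp del: of_nat_Suc of_nat_add)
    moreover have "(of_real (real v + 1) :: 'a) = of_nat (v + 1)" by simp
    ultimately show ?thesis
      unfolding T_def t_mean_def scaleR_conv_of_real by (simp del: of_nat_Suc of_nat_add)
  qed
  have parts: "(\<Sum>v=1..m. g v * (of_nat v * a v)) = g m * T m + (\<Sum>v=1..m-1. (g v - g (Suc v)) * T v)"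
    if "m \<ge> 1" for m
    using that
  proof (induction m rule: dec_induct)
    case (step m)
    then obtain l where "m = Suc l" by (cases m) auto
    with step show ?case by (simp add: T_def algebra_simps)
  qed (simp add: T_def)
  have summand: "(g v - g (Suc v)) * T v =
      ((real v + 1) / real v * (A n v - A (n - 1) v)) *\<^sub>R (lam v * t_mean a v)
        + ((real v + 1) / real v * h (Suc v)) *\<^sub>R (fwd_diff lam v * t_mean a v)
        + (h (Suc v) / real v) *\<^sub>R (lam (Suc v) * t_mean a v)" if v: "v \<in> {1..n-1}" for v
  proof -
    have hv: "A n v - A (n - 1) v = h v - h (Suc v)"
      unfolding h_def using v n by (intro hat_matrix_diff[symmetric]) auto
    define r where "r = real v"
    have r: "r > 0" "real (Suc v) = r + 1" using v by (auto simp: r_def)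
    have "(g v - g (Suc v)) * T v = (((r + 1) / r * h v) *\<^sub>R lam v - h (Suc v) *\<^sub>R lam (Suc v)) * t_mean a v"
    proof -
      have "(r + 1) *\<^sub>R g v = ((r + 1) / r * h v) *\<^sub>R lam v"
        "(r + 1) *\<^sub>R g (Suc v) = h (Suc v) *\<^sub>R lam (Suc v)"
        using r by (auto simp: g_def r_def[symmetric] simp del: of_nat_Suc)
      moreover have "(g v - g (Suc v)) * T v = ((r + 1) *\<^sub>R g v - (r + 1) *\<^sub>R g (Suc v)) * t_mean a v"
        by (simp add: T r_def[symmetric] flip: scaleR_diff_right)
      ultimately show ?thesis by simp
    qed
    \<comment> \<open>The term with \<open>\<lambda>\<^bsub>v+1\<^esub>\<close> arises from
      \<open>1 = (r + 1)/r - 1/r\<close>, which also yields the common factor \<open>(r + 1)/r\<close> in the other two.\<close>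
    also have "((r + 1) / r * h v) *\<^sub>R lam v - h (Suc v) *\<^sub>R lam (Suc v) =
       ((r + 1) / r * (h v - h (Suc v))) *\<^sub>R lam v
       + ((r + 1) / r * h (Suc v)) *\<^sub>R (lam v - lam (Suc v)) + (h (Suc v) / r) *\<^sub>R lam (Suc v)"
    proof -
      have "h (Suc v) = (r + 1) / r * h (Suc v) - h (Suc v) / r" using r by (simp add: field_simps)
      then have "h (Suc v) *\<^sub>R lam (Suc v) = ((r + 1) / r * h (Suc v)) *\<^sub>R lam (Suc v) - (h (Suc v) / r) *\<^sub>R lam (Suc v)"
        by (metis scaleR_diff_left)
      then show ?thesis by (simp add: algebra_simps)
    qed
    finally show ?thesis by (simp only: hv r_def fwd_diff_def distrib_right mult_scaleR_left)
  qed
  have "(\<Sum>v=1..n. h v *\<^sub>R (a v * lam v)) = (\<Sum>v=1..n. g v * (of_nat v * a v))"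
    by (intro sum.cong) (auto simp: g_def scaleR_conv_of_real)
  also have "\<dots> = g n * T n + (\<Sum>v=1..n-1. (g v - g (Suc v)) * T v)"
    by (rule parts[OF n])
  also have "g n * T n = ((real n + 1) / real n * A n n) *\<^sub>R (lam n * t_mean a n)"
    by (simp add: g_def T h_def hat_matrix_diag[OF n] mult_ac)
  also have "(\<Sum>v=1..n-1. (g v - g (Suc v)) * T v) = (\<Sum>v=1..n-1.
      ((real v + 1) / real v * (A n v - A (n - 1) v)) *\<^sub>R (lam v * t_mean a v)
        + ((real v + 1) / real v * h (Suc v)) *\<^sub>R (fwd_diff lam v * t_mean a v)
        + (h (Suc v) / real v) *\<^sub>R (lam (Suc v) * t_mean a v))"
    by (rule sum.cong[OF refl summand])
  finally show ?thesis by (simp add: h_def)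
qed

text \<open>
  The factor 2 bounds \<open>(v + 1) / v\<close>. In the third sum \<open>v\<close> is cancelled and
  reinserted, so that its kernel is the one of the fourth sum and has row sums of order
  \<open>a\<^sub>n\<^sub>n\<close>.
\<close>
lemma norm_sum_hat_matrix_le:
  fixes a lam :: "nat \<Rightarrow> 'a::real_normed_field"
  assumes rows: "\<And>n. bar_matrix A n 0 = 1"
    and cols: "\<And>n v. n \<ge> v + 1 \<Longrightarrow> A (n - 1) v \<ge> A n v"
    and diag: "A n n \<ge> 0" and n: "n \<ge> 1"
  shows "norm (\<Sum>v=1..n. hat_matrix A n v *\<^sub>R (a v * lam v)) \<le> 2 *
    (A n n * (norm (lam n) * norm (t_mean a n))
     + (\<Sum>v=1..n-1. (A (n - 1) v - A n v) * (norm (lam v) * norm (t_mean a v)))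
     + (\<Sum>v=1..n-1. hat_matrix A n (Suc v) / real v
          * (real v * norm (fwd_diff lam v) * norm (t_mean a v)))
     + (\<Sum>v=1..n-1. hat_matrix A n (Suc v) / real v * (norm (lam (Suc v)) * norm (t_mean a v))))"
proof -
  define x where "x v = norm (t_mean a v)" for v
  define b1 b2 where "b1 v = A (n - 1) v - A n v" and "b2 v = hat_matrix A n (Suc v) / real v" for v
  define y1 y2 y3 where "y1 v = norm (lam v) * x v"
    and "y2 v = real v * norm (fwd_diff lam v) * x v" and "y3 v = norm (lam (Suc v)) * x v" for v
  have y_nonneg: "y1 v \<ge> 0" "y2 v \<ge> 0" "y3 v \<ge> 0" for v
    by (auto simp: x_def y1_def y2_def y3_def)
  have two: "(real v + 1) / real v \<le> 2" if "v \<ge> 1" for v using that by (simp add: field_simps)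
  have "norm (\<Sum>v=1..n. hat_matrix A n v *\<^sub>R (a v * lam v)) \<le> norm (((real n + 1) / real n * A n n) *\<^sub>R (lam n * t_mean a n))
    + (\<Sum>v=1..n-1. norm (((real v + 1) / real v * (A n v - A (n - 1) v)) *\<^sub>R (lam v * t_mean a v)
      + ((real v + 1) / real v * hat_matrix A n (Suc v)) *\<^sub>R (fwd_diff lam v * t_mean a v)
      + (hat_matrix A n (Suc v) / real v) *\<^sub>R (lam (Suc v) * t_mean a v)))"
    unfolding sum_hat_matrix_by_parts[OF n]
    by (auto intro!: order.trans[OF norm_triangle_ineq] add_mono norm_sum)
  also have "norm (((real n + 1) / real n * A n n) *\<^sub>R (lam n * t_mean a n))
      = (real n + 1) / real n * (A n n * y1 n)"
    using diag by (simp add: y1_def x_def norm_mult abs_mult)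
  also have "\<dots> \<le> 2 * (A n n * y1 n)" using diag y_nonneg(1)[of n] by (intro mult_right_mono two n) auto
  also have "(\<Sum>v=1..n-1. norm (((real v + 1) / real v * (A n v - A (n - 1) v)) *\<^sub>R (lam v * t_mean a v)
      + ((real v + 1) / real v * hat_matrix A n (Suc v)) *\<^sub>R (fwd_diff lam v * t_mean a v)
      + (hat_matrix A n (Suc v) / real v) *\<^sub>R (lam (Suc v) * t_mean a v)))
    \<le> (\<Sum>v=1..n-1. 2 * (b1 v * y1 v) + 2 * (b2 v * y2 v) + 2 * (b2 v * y3 v))"
  proof (rule sum_mono)
    fix v assume v: "v \<in> {1..n-1}"
    then have v': "v \<ge> 1" "v < n" by auto
    define r where "r = (real v + 1) / real v"
    have r: "0 \<le> r" "r \<le> 2" using two[OF v'(1)] by (auto simp: r_def)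
    have h: "hat_matrix A n (Suc v) \<ge> 0" using v' by (intro hat_matrix_nonneg rows cols) auto
    have b: "b1 v \<ge> 0" "b2 v \<ge> 0" using cols[of v n] v' h by (auto simp: b1_def b2_def)
    have "norm ((r * (A n v - A (n - 1) v)) *\<^sub>R (lam v * t_mean a v)) = r * (b1 v * y1 v)"
      using r b(1) by (simp add: b1_def y1_def x_def norm_mult abs_mult)
    also have "\<dots> \<le> 2 * (b1 v * y1 v)" using r b y_nonneg by (intro mult_right_mono) auto
    finally have 1: "norm ((r * (A n v - A (n - 1) v)) *\<^sub>R (lam v * t_mean a v)) \<le> 2 * (b1 v * y1 v)" .
    have "norm ((r * hat_matrix A n (Suc v)) *\<^sub>R (fwd_diff lam v * t_mean a v)) = r * (b2 v * y2 v)"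
      using r h v' by (simp add: b2_def y2_def x_def norm_mult abs_mult)
    also have "\<dots> \<le> 2 * (b2 v * y2 v)" using r b y_nonneg by (intro mult_right_mono) auto
    finally have 2: "norm ((r * hat_matrix A n (Suc v)) *\<^sub>R (fwd_diff lam v * t_mean a v)) \<le> 2 * (b2 v * y2 v)" .
    have "norm ((hat_matrix A n (Suc v) / real v) *\<^sub>R (lam (Suc v) * t_mean a v)) = b2 v * y3 v"
      using h by (simp add: b2_def y3_def x_def norm_mult abs_mult)
    also have "\<dots> \<le> 2 * (b2 v * y3 v)" using b y_nonneg(3)[of v] by simp
    finally have 3: "norm ((hat_matrix A n (Suc v) / real v) *\<^sub>R (lam (Suc v) * t_mean a v)) \<le> 2 * (b2 v * y3 v)" .
    show "norm (((real v + 1) / real v * (A n v - A (n - 1) v)) *\<^sub>R (lam v * t_mean a v)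
      + ((real v + 1) / real v * hat_matrix A n (Suc v)) *\<^sub>R (fwd_diff lam v * t_mean a v)
      + (hat_matrix A n (Suc v) / real v) *\<^sub>R (lam (Suc v) * t_mean a v))
      \<le> 2 * (b1 v * y1 v) + 2 * (b2 v * y2 v) + 2 * (b2 v * y3 v)"
      unfolding r_def[symmetric]
      by (intro order.trans[OF norm_triangle_ineq] add_mono 1 2 3)
  qed
  also have "\<dots> = 2 * (\<Sum>v=1..n-1. b1 v * y1 v) + 2 * (\<Sum>v=1..n-1. b2 v * y2 v) + 2 * (\<Sum>v=1..n-1. b2 v * y3 v)"
    by (simp add: sum.distrib sum_distrib_left)
  finally have "norm (\<Sum>v=1..n. hat_matrix A n v *\<^sub>R (a v * lam v)) \<le> 2 *
      (A n n * y1 n + (\<Sum>v=1..n-1. b1 v * y1 v) + (\<Sum>v=1..n-1. b2 v * y2 v)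
       + (\<Sum>v=1..n-1. b2 v * y3 v))" by simp
  then show ?thesis by (simp only: b1_def b2_def y1_def y2_def y3_def x_def)
qed

section \<open>Summability of the series with factors\<close>

text \<open>
  Finitely many exceptional indices only enlarge the constant, since the comparison sequence has
  no zeros from index 1 on. Index 0 has to stay out because \<open>X 0\<close> is arbitrary.
\<close>
lemma bigo_imp_le_from_one:
  fixes f :: "nat \<Rightarrow> 'a::real_normed_vector" and g :: "nat \<Rightarrow> real"
  assumes fg: "(\<lambda>n. norm (f n)) \<in> O(g)" and g: "\<And>n. n \<ge> 1 \<Longrightarrow> g n > 0"
  obtains C where "C > 0" and "\<And>n. n \<ge> 1 \<Longrightarrow> norm (f n) \<le> C * g n"
proof -
  from fg obtain C0 where C0: "C0 > 0" and ev: "eventually (\<lambda>n. norm (f n) \<le> C0 * \<bar>g n\<bar>) sequentially"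
    by (auto elim!: landau_o.bigE)
  from ev obtain N where N: "\<And>n. n \<ge> N \<Longrightarrow> norm (f n) \<le> C0 * \<bar>g n\<bar>"
    by (auto simp: eventually_sequentially)
  define C where "C = C0 + (\<Sum>i=1..N. norm (f i) / g i)"
  have terms: "norm (f i) / g i \<ge> 0" if "i \<in> {1..N}" for i
    using g[of i] that by auto
  have "C \<ge> C0" unfolding C_def using sum_nonneg[of "{1..N}", OF terms] by simp
  have "norm (f n) \<le> C * g n" if n: "n \<ge> 1" for n
  proof (cases "n \<ge> N")
    case True
    have "norm (f n) \<le> C0 * g n" using N[OF True] g[OF n] by simp
    also have "\<dots> \<le> C * g n" using \<open>C \<ge> C0\<close> g[OF n] by (intro mult_right_mono) auto
    finally show ?thesis .
  next
    case False
    have "norm (f n) / g n \<le> (\<Sum>i=1..N. norm (f i) / g i)"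
      using n False terms by (intro member_le_sum) auto
    then have "norm (f n) / g n \<le> C" using C0 by (simp add: C_def)
    then show ?thesis using g[OF n] by (simp add: field_simps)
  qed
  then show ?thesis using that[of C] \<open>C \<ge> C0\<close> C0 by auto
qed

theorem theorem3p1:
  fixes k \<sigma> \<beta> :: real
    and p X :: "nat \<Rightarrow> real"
    and a lam :: "nat \<Rightarrow> 'a::{real_normed_field,banach}"
    and A :: "nat \<Rightarrow> nat \<Rightarrow> real"
  assumes "k \<ge> 1"
    and "\<And>n. p n > 0"
    and "filterlim (psum p) at_top sequentially"
    and "\<beta> \<ge> 0" and "0 < \<sigma>" and "\<sigma> < 1"
    and "quasi_power_increasing (pow_log \<sigma> \<beta>) X"
    and "positive_normal_matrix A"
    and "\<And>n. bar_matrix A n 0 = 1"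
    and "\<And>n v. n \<ge> v + 1 \<Longrightarrow> A (n - 1) v \<ge> A n v"
    and "(\<lambda>n. A n n) \<in> O(\<lambda>n. p n / psum p n)"
    and "(\<lambda>n. \<Sum>v=1..n-1. 1 / real v * hat_matrix A n (v + 1)) \<in> O(\<lambda>n. A n n)"
    and "(\<lambda>m. X m *\<^sub>R lam m) \<in> O(\<lambda>_. 1)"
    and "(\<lambda>m. \<Sum>n=1..m. real n * X n * norm (fwd_diff (fwd_diff lam) n)) \<in> O(\<lambda>_. 1)"
    and "(\<lambda>m. \<Sum>n=1..m. psum p n / real n) \<in> O(psum p)"
    and "(\<lambda>m. \<Sum>n=1..m. p n / psum p n * (norm (t_mean a n) powr k / X n powr (k - 1))) \<in> O(X)"
    and "(\<lambda>m. \<Sum>n=1..m. norm (t_mean a n) powr k / (real n * X n powr (k - 1))) \<in> O(X)"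
  shows "abs_summable A p k (\<lambda>n. if n = 0 then 0 else a n * lam n)"
proof -
  note k = assms(1) and p_pos = assms(2) and rows = assms(9) and cols = assms(10)
  define x where "x n = norm (t_mean a n)" for n
  define q where "q n = psum p n / p n" for n
  define b1 where "b1 n v = A (n - 1) v - A n v" for n v
  define b2 where "b2 n v = hat_matrix A n (Suc v) / real v" for n v
  define y1 where "y1 v = norm (lam v) * x v" for v
  define y2 where "y2 v = real v * norm (fwd_diff lam v) * x v" for v
  define y3 where "y3 v = norm (lam (Suc v)) * x v" for v

  have A_pos: "A n v > 0" if "v \<le> n" for n v
    using assms(8) that by (simp add: positive_normal_matrix_def)
  have X_pos: "X n > 0" if "n \<ge> 1" for n
    using assms(7) that by (simp add: quasi_power_increasing_def)
  have P_pos: "psum p n > 0" for n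
    unfolding psum_def using p_pos by (intro sum_pos) auto
  have q_pos: "q n > 0" for n using P_pos p_pos by (simp add: q_def)
  have x_nonneg: "x n \<ge> 0" for n by (simp add: x_def)

  obtain M1 where M1: "M1 > 0" "\<And>n. n \<ge> 1 \<Longrightarrow> A n n \<le> M1 * (p n / psum p n)"
  proof (rule bigo_imp_le_from_one[of "\<lambda>n. A n n" "\<lambda>n. p n / psum p n"])
  qed (use assms(11) p_pos P_pos in \<open>auto simp: abs_le_iff\<close>)
  obtain M2 where M2: "M2 > 0"
    "\<And>n. n \<ge> 1 \<Longrightarrow> (\<Sum>v=1..n-1. 1 / real v * hat_matrix A n (v + 1)) \<le> M2 * A n n"
  proof (rule bigo_imp_le_from_one[of "\<lambda>n. \<Sum>v=1..n-1. 1 / real v * hat_matrix A n (v + 1)" "\<lambda>n. A n n"])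
  qed (use assms(12) A_pos in \<open>auto simp: abs_le_iff\<close>)
  obtain L where L: "L > 0" "\<And>n. n \<ge> 1 \<Longrightarrow> norm (X n *\<^sub>R lam n) \<le> L * 1"
  proof (rule bigo_imp_le_from_one[of "\<lambda>n. X n *\<^sub>R lam n" "\<lambda>_. 1"])
  qed (use assms(13) in \<open>auto simp: bigo_def\<close>)
  obtain B where B: "B > 0"
    "\<And>m. m \<ge> 1 \<Longrightarrow> (\<Sum>n=1..m. real n * X n * norm (fwd_diff (fwd_diff lam) n)) \<le> B * 1"
  proof (rule bigo_imp_le_from_one[of "\<lambda>m. \<Sum>n=1..m. real n * X n * norm (fwd_diff (fwd_diff lam) n)" "\<lambda>_. 1"])
  qed (use assms(14) in \<open>auto simp: abs_le_iff\<close>)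
  obtain D1 where D1: "D1 > 0"
    "\<And>m. m \<ge> 1 \<Longrightarrow> (\<Sum>n=1..m. p n / psum p n * (x n powr k / X n powr (k - 1))) \<le> D1 * X m"
  proof (rule bigo_imp_le_from_one[of "\<lambda>m. \<Sum>n=1..m. p n / psum p n * (x n powr k / X n powr (k - 1))" X])
  qed (use assms(16) X_pos in \<open>auto simp: abs_le_iff x_def\<close>)
  obtain D2 where D2: "D2 > 0"
    "\<And>m. m \<ge> 1 \<Longrightarrow> (\<Sum>n=1..m. x n powr k / (real n * X n powr (k - 1))) \<le> D2 * X m"
  proof (rule bigo_imp_le_from_one[of "\<lambda>m. \<Sum>n=1..m. x n powr k / (real n * X n powr (k - 1))" X])
  qed (use assms(17) X_pos in \<open>auto simp: abs_le_iff x_def\<close>)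
  \<comment> \<open>Any exponent strictly between \<open>\<sigma>\<close> and 1 would do in place of the midpoint.\<close>
  obtain C where C: "C \<ge> 1"
    "\<And>m n. 1 \<le> m \<Longrightarrow> m \<le> n \<Longrightarrow> real m * X m \<le> C * (real n * X n)"
    "\<And>n. 1 \<le> n \<Longrightarrow> (\<Sum>m=1..n. X m) \<le> C * (real n * X n)"
  proof (rule quasi_power_increasing_bounds[of "(\<sigma> + 1) / 2" X])
    show "quasi_power_increasing (pow_log ((\<sigma> + 1) / 2) 0) X"
      using assms(4-7) by (intro quasi_power_increasing_absorb_log[of \<beta> \<sigma>]) auto
  qed (use assms(5,6) in auto)

  have L': "X n * norm (lam n) \<le> L" if "n \<ge> 1" for n
    using L(2)[OF that] X_pos[OF that] by simp
  have B': "(\<Sum>n=1..m. real n * X n * norm (fwd_diff (fwd_diff lam) n)) \<le> B" for m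
    using B(1) B(2)[of m] by (cases "m = 0") auto
  define G where "G = L + 2 * C * L + C * B"
  have G: "real n * X n * norm (fwd_diff lam n) \<le> G" if "n \<ge> 1" for n
    unfolding G_def using C(1,2) X_pos that by (intro fwd_diff_weighted_bound L' B') auto
  define E where "E = C * (B + G)"
  have E: "(\<Sum>n=1..m. X n * norm (fwd_diff lam n)) \<le> E" for m
    unfolding E_def using C X_pos by (intro sum_fwd_diff_weighted_bound B' G) auto
  \<comment> \<open>Shifting the index of \<open>X\<close> by one costs a constant, so \<open>\<lambda>\<^bsub>v+1\<^esub>\<close> can be treated like
    \<open>\<lambda>\<^sub>v\<close>.\<close>
  have X_Suc: "X n \<le> 2 * C * X (Suc n)" if n: "n \<ge> 1" for n
  proof -
    have "real n * X n \<le> C * (real (Suc n) * X (Suc n))" using C(2)[of n "Suc n"] n by simp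
    also have "\<dots> \<le> C * (2 * real n * X (Suc n))"
      using C(1) n X_pos[of "Suc n"] by (intro mult_left_mono mult_right_mono) auto
    finally have "real n * X n \<le> real n * (2 * C * X (Suc n))" by (simp add: mult_ac)
    then show ?thesis using n by simp
  qed
  have E_Suc: "(\<Sum>n=1..m. X n * norm (fwd_diff lam (Suc n))) \<le> 2 * C * E" for m
  proof -
    have "(\<Sum>n=1..m. X n * norm (fwd_diff lam (Suc n)))
        \<le> (\<Sum>n=1..m. 2 * C * X (Suc n) * norm (fwd_diff lam (Suc n)))"
      using X_Suc by (intro sum_mono mult_right_mono) auto
    also have "\<dots> = 2 * C * (\<Sum>n=1..m. X (Suc n) * norm (fwd_diff lam (Suc n)))"
      by (simp add: sum_distrib_left mult_ac)
    also have "(\<Sum>n=1..m. X (Suc n) * norm (fwd_diff lam (Suc n)))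
        = (\<Sum>n=Suc 1..Suc m. X n * norm (fwd_diff lam n))"
      by (rule sum.shift_bounds_cl_Suc_ivl[symmetric])
    also have "\<dots> \<le> (\<Sum>n=1..Suc m. X n * norm (fwd_diff lam n))"
      using X_pos by (intro sum_mono2) (auto simp: less_imp_le)
    also have "\<dots> \<le> E" by (rule E)
    finally show ?thesis using C(1) by simp
  qed

  \<comment> \<open>The three applications of \<open>sum_powr_factor_bound\<close>, with \<open>c\<^sub>v\<close> equal to
    \<open>|\<lambda>\<^sub>v|\<close>, \<open>v |\<Delta>\<lambda>\<^sub>v|\<close> and
    \<open>|\<lambda>\<^bsub>v+1\<^esub>|\<close>.\<close>
  obtain B1 where B1: "\<And>m. (\<Sum>v=1..m. p v / psum p v * y1 v powr k) \<le> B1"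
  proof -
    have "(\<Sum>n=1..m. X n * \<bar>norm (lam n) - norm (lam (Suc n))\<bar>) \<le> E" for m
    proof -
      have "(\<Sum>n=1..m. X n * \<bar>norm (lam n) - norm (lam (Suc n))\<bar>)
          \<le> (\<Sum>n=1..m. X n * norm (fwd_diff lam n))"
        using X_pos by (intro sum_mono mult_left_mono)
          (auto simp: fwd_diff_def norm_triangle_ineq3 less_imp_le)
      also note E
      finally show ?thesis .
    qed
    then have "(\<Sum>v=1..m. p v / psum p v * (norm (lam v) * x v) powr k) \<le> L powr (k - 1) * (D1 * (E + L))" for m
      using k X_pos D1 L' x_nonneg p_pos P_pos
      by (intro sum_powr_factor_bound[where X = X]) (auto simp: less_imp_le mult.commute)
    then show ?thesis by (intro that) (simp add: y1_def)
  qed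
  have D2': "(\<Sum>n=1..m. 1 / real n * (x n powr k / X n powr (k - 1))) \<le> D2 * X m" if "m \<ge> 1" for m
    using D2(2)[OF that] by simp
  obtain B2 where B2: "\<And>m. (\<Sum>v=1..m. 1 / real v * y2 v powr k) \<le> B2"
  proof -
    have "(\<Sum>n=1..m. X n * \<bar>real n * norm (fwd_diff lam n) - real (Suc n) * norm (fwd_diff lam (Suc n))\<bar>)
        \<le> B + 2 * C * E" for m
    proof -
      have "(\<Sum>n=1..m. X n * \<bar>real n * norm (fwd_diff lam n) - real (Suc n) * norm (fwd_diff lam (Suc n))\<bar>)
        \<le> (\<Sum>n=1..m. real n * X n * norm (fwd_diff (fwd_diff lam) n) + X n * norm (fwd_diff lam (Suc n)))"
      proof (rule sum_mono)
        fix n assume n: "n \<in> {1..m}"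
        have "X n * \<bar>real n * norm (fwd_diff lam n) - real (Suc n) * norm (fwd_diff lam (Suc n))\<bar>
            \<le> X n * (real n * norm (fwd_diff (fwd_diff lam) n) + norm (fwd_diff lam (Suc n)))"
          using X_pos[of n] n by (intro mult_left_mono abs_index_mult_norm_diff_le) auto
        then show "X n * \<bar>real n * norm (fwd_diff lam n) - real (Suc n) * norm (fwd_diff lam (Suc n))\<bar>
            \<le> real n * X n * norm (fwd_diff (fwd_diff lam) n) + X n * norm (fwd_diff lam (Suc n))"
          by (simp add: algebra_simps)
      qed
      also have "\<dots> \<le> B + 2 * C * E"
        unfolding sum.distrib by (intro add_mono B' E_Suc)
      finally show ?thesis .
    qed
    then have "(\<Sum>v=1..m. 1 / real v * (real v * norm (fwd_diff lam v) * x v) powr k)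
        \<le> G powr (k - 1) * (D2 * ((B + 2 * C * E) + G))" for m
      using k X_pos D2(1) D2' G x_nonneg
      by (intro sum_powr_factor_bound[where X = X]) (auto simp: mult_ac)
    then show ?thesis by (intro that) (simp add: y2_def)
  qed
  obtain B3 where B3: "\<And>m. (\<Sum>v=1..m. 1 / real v * y3 v powr k) \<le> B3"
  proof -
    have "(\<Sum>n=1..m. X n * \<bar>norm (lam (Suc n)) - norm (lam (Suc (Suc n)))\<bar>) \<le> 2 * C * E" for m
    proof -
      have "(\<Sum>n=1..m. X n * \<bar>norm (lam (Suc n)) - norm (lam (Suc (Suc n)))\<bar>)
          \<le> (\<Sum>n=1..m. X n * norm (fwd_diff lam (Suc n)))"
        using X_pos by (intro sum_mono mult_left_mono)
          (auto simp: fwd_diff_def norm_triangle_ineq3 less_imp_le)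
      also note E_Suc
      finally show ?thesis .
    qed
    moreover have "norm (lam (Suc n)) * X n \<le> 2 * C * L" if n: "n \<ge> 1" for n
    proof -
      have "norm (lam (Suc n)) * X n \<le> norm (lam (Suc n)) * (2 * C * X (Suc n))"
        by (intro mult_left_mono X_Suc n) auto
      also have "\<dots> = 2 * C * (X (Suc n) * norm (lam (Suc n)))" by simp
      also have "\<dots> \<le> 2 * C * L" using L'[of "Suc n"] C(1) by (intro mult_left_mono) auto
      finally show ?thesis .
    qed
    ultimately have "(\<Sum>v=1..m. 1 / real v * (norm (lam (Suc v)) * x v) powr k)
        \<le> (2 * C * L) powr (k - 1) * (D2 * (2 * C * E + 2 * C * L))" for m
      using k X_pos D2(1) D2' x_nonneg
      by (intro sum_powr_factor_bound[where X = X]) auto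
    then show ?thesis by (intro that) (simp add: y3_def)
  qed

  have y_nonneg: "y1 v \<ge> 0" "y2 v \<ge> 0" "y3 v \<ge> 0" for v
    using x_nonneg by (auto simp: y1_def y2_def y3_def)
  have b1_nonneg: "b1 n v \<ge> 0" if "v < n" for n v
    using cols[of v n] that by (simp add: b1_def)
  have hat_nonneg: "hat_matrix A n (Suc v) \<ge> 0" if "v < n" for n v
    using that by (intro hat_matrix_nonneg rows cols) auto
  then have b2_nonneg: "b2 n v \<ge> 0" if "v < n" for n v
    using that by (simp add: b2_def)
  have diag: "A n n \<le> M1 / q n" if "n \<ge> 1" for n
    using M1(2)[OF that] by (simp add: q_def)

  define I1 I2 I3 I4 where "I1 n = A n n * y1 n" and "I2 n = (\<Sum>v=1..n-1. b1 n v * y1 v)"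
    and "I3 n = (\<Sum>v=1..n-1. b2 n v * y2 v)" and "I4 n = (\<Sum>v=1..n-1. b2 n v * y3 v)" for n
  have I_nonneg: "I1 n \<ge> 0" "I2 n \<ge> 0" "I3 n \<ge> 0" "I4 n \<ge> 0" for n
    unfolding I1_def I2_def I3_def I4_def using A_pos[of n n] y_nonneg b1_nonneg b2_nonneg
    by (auto intro!: sum_nonneg mult_nonneg_nonneg)

  have B1': "(\<Sum>v=1..m. A v v * y1 v powr k) \<le> M1 * B1" for m
  proof -
    have "(\<Sum>v=1..m. A v v * y1 v powr k) \<le> (\<Sum>v=1..m. M1 * (p v / psum p v) * y1 v powr k)"
      using M1(2) by (intro sum_mono mult_right_mono) auto
    also have "\<dots> = M1 * (\<Sum>v=1..m. p v / psum p v * y1 v powr k)"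
      by (simp add: sum_distrib_left mult_ac)
    also have "\<dots> \<le> M1 * B1" using B1[of m] M1(1) by (intro mult_left_mono) auto
    finally show ?thesis .
  qed
  \<comment> \<open>The diagonal term needs no exchange of sums: \<open>q\<^sub>n a\<^sub>n\<^sub>n\<close> is bounded, so one
    factor \<open>a\<^sub>n\<^sub>n\<close> survives.\<close>
  have S1: "(\<Sum>n=1..m. q n powr (k - 1) * I1 n powr k) \<le> M1 powr (k - 1) * (M1 * B1)" for m
  proof -
    have "(\<Sum>n=1..m. q n powr (k - 1) * I1 n powr k)
       \<le> (\<Sum>n=1..m. M1 powr (k - 1) * (A n n * y1 n powr k))"
    proof (rule sum_mono)
      fix n assume n: "n \<in> {1..m}"
      have "q n powr (k - 1) * I1 n powr k = (q n * A n n) powr (k - 1) * (A n n * y1 n powr k)"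
        using A_pos[of n n] q_pos[of n] y_nonneg(1)[of n] by (simp add: I1_def powr_mult powr_diff)
      also have "\<dots> \<le> M1 powr (k - 1) * (A n n * y1 n powr k)"
        using A_pos[of n n] q_pos[of n] diag[of n] n k
        by (intro mult_right_mono powr_mono2) (auto simp: field_simps)
      finally show "q n powr (k - 1) * I1 n powr k \<le> M1 powr (k - 1) * (A n n * y1 n powr k)" .
    qed
    also have "\<dots> = M1 powr (k - 1) * (\<Sum>n=1..m. A n n * y1 n powr k)"
      by (simp add: sum_distrib_left)
    also have "\<dots> \<le> M1 powr (k - 1) * (M1 * B1)" by (intro mult_left_mono B1') auto
    finally show ?thesis .
  qed
  have S2: "(\<Sum>n=1..m. q n powr (k - 1) * I2 n powr k) \<le> M1 powr (k - 1) * (M1 * B1)" for m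
    unfolding I2_def
  proof (rule sum_triangle_kernel_powr_bound[where g = "\<lambda>v. A v v"])
    show "(\<Sum>v=1..n-1. b1 n v) \<le> M1 / q n" if "n \<ge> 1" for n
      using sum_row_decrease_le_diag[OF rows cols that] diag[OF that] by (simp add: b1_def)
    show "(\<Sum>n=Suc v..m. b1 n v) \<le> A v v" for v m
      unfolding b1_def using A_pos by (intro sum_column_decrease_le_diag) (auto simp: less_imp_le)
  qed (use k q_pos b1_nonneg y_nonneg B1' in auto)
  have row2: "(\<Sum>v=1..n-1. b2 n v) \<le> (M2 * M1) / q n" if "n \<ge> 1" for n
  proof -
    have "(\<Sum>v=1..n-1. b2 n v) \<le> M2 * A n n" using M2(2)[OF that] by (simp add: b2_def)
    also have "\<dots> \<le> M2 * (M1 / q n)" using diag[OF that] M2(1) by (intro mult_left_mono) auto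
    finally show ?thesis by simp
  qed
  have col2: "(\<Sum>n=Suc v..m. b2 n v) \<le> 1 / real v" for v m
  proof -
    have "(\<Sum>n=Suc v..m. hat_matrix A n (Suc v)) \<le> 1"
      using A_pos by (intro sum_column_hat_matrix_le_one rows) (auto simp: less_imp_le)
    then show ?thesis unfolding b2_def sum_divide_distrib[symmetric] by (intro divide_right_mono) auto
  qed
  have S3: "(\<Sum>n=1..m. q n powr (k - 1) * I3 n powr k) \<le> (M2 * M1) powr (k - 1) * B2" for m
    unfolding I3_def
    by (rule sum_triangle_kernel_powr_bound[where g = "\<lambda>v. 1 / real v"])
       (use k q_pos b2_nonneg y_nonneg B2 row2 col2 in auto)
  have S4: "(\<Sum>n=1..m. q n powr (k - 1) * I4 n powr k) \<le> (M2 * M1) powr (k - 1) * B3" for m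
    unfolding I4_def
    by (rule sum_triangle_kernel_powr_bound[where g = "\<lambda>v. 1 / real v"])
       (use k q_pos b2_nonneg y_nonneg B3 row2 col2 in auto)

  define c where "c n = (if n = 0 then 0 else a n * lam n)" for n
  define \<Delta> where "\<Delta> n = matrix_transform A (psum c) n - matrix_transform A (psum c) (n - 1)" for n
  have norm_\<Delta>: "norm (\<Delta> n) \<le> 2 * (I1 n + I2 n + I3 n + I4 n)" if n: "n \<ge> 1" for n
  proof -
    have "\<Delta> n = (\<Sum>v=0..n. hat_matrix A n v *\<^sub>R c v)"
      unfolding \<Delta>_def by (rule matrix_transform_diff[OF n])
    also have "\<dots> = (\<Sum>v=1..n. hat_matrix A n v *\<^sub>R (a v * lam v))"
      by (simp add: sum.atLeast_Suc_atMost[of 0] c_def)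
    also have "norm \<dots> \<le> 2 * (I1 n + I2 n + I3 n + I4 n)"
      unfolding I1_def I2_def I3_def I4_def b1_def b2_def y1_def y2_def y3_def x_def
      using A_pos by (intro norm_sum_hat_matrix_le n rows cols) (auto simp: less_imp_le)
    finally show ?thesis .
  qed
  have powr_\<Delta>: "norm (\<Delta> n) powr k \<le>
      8 powr (k - 1) * 2 * (I1 n powr k + I2 n powr k + I3 n powr k + I4 n powr k)"
    if n: "n \<ge> 1" for n
  proof -
    have "norm (\<Delta> n) powr k \<le> (2 * (I1 n + I2 n + I3 n + I4 n)) powr k"
      using k norm_\<Delta>[OF n] by (intro powr_mono2) auto
    also have "\<dots> \<le> 8 powr (k - 1) * 2 * (I1 n powr k + I2 n powr k + I3 n powr k + I4 n powr k)"
      by (intro powr_sum4_le k I_nonneg)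
    finally show ?thesis .
  qed
  define R where "R = 8 powr (k - 1) * 2 * (M1 powr (k - 1) * (M1 * B1) + M1 powr (k - 1) * (M1 * B1)
      + (M2 * M1) powr (k - 1) * B2 + (M2 * M1) powr (k - 1) * B3)"
  have total: "(\<Sum>n=1..m. q n powr (k - 1) * norm (\<Delta> n) powr k) \<le> R" for m
  proof -
    have "(\<Sum>n=1..m. q n powr (k - 1) * norm (\<Delta> n) powr k) \<le> (\<Sum>n=1..m. q n powr (k - 1) *
        (8 powr (k - 1) * 2 * (I1 n powr k + I2 n powr k + I3 n powr k + I4 n powr k)))"
      by (intro sum_mono mult_left_mono powr_\<Delta>) auto
    also have "\<dots> = 8 powr (k - 1) * 2 *
       ((\<Sum>n=1..m. q n powr (k - 1) * I1 n powr k) + (\<Sum>n=1..m. q n powr (k - 1) * I2 n powr k)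
       + (\<Sum>n=1..m. q n powr (k - 1) * I3 n powr k) + (\<Sum>n=1..m. q n powr (k - 1) * I4 n powr k))"
      unfolding sum.distrib[symmetric] sum_distrib_left
      by (intro sum.cong) (auto simp: algebra_simps)
    also have "\<dots> \<le> R" unfolding R_def by (intro mult_left_mono add_mono S1 S2 S3 S4) auto
    finally show ?thesis .
  qed
  have "summable (\<lambda>n. q (Suc n) powr (k - 1) * norm (\<Delta> (Suc n)) powr k)"
  proof (rule bounded_imp_summable)
    fix m
    have "(\<Sum>n\<le>m. q (Suc n) powr (k - 1) * norm (\<Delta> (Suc n)) powr k)
        = (\<Sum>n=1..Suc m. q n powr (k - 1) * norm (\<Delta> n) powr k)"
      by (simp only: atMost_atLeast0 One_nat_def sum.shift_bounds_cl_Suc_ivl)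
    then show "(\<Sum>n\<le>m. q (Suc n) powr (k - 1) * norm (\<Delta> (Suc n)) powr k) \<le> R"
      using total[of "Suc m"] by simp
  qed simp
  then show ?thesis
    by (simp add: abs_summable_def q_def \<Delta>_def c_def[abs_def])
qed

end
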